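(* Let $\alpha,\beta,\gamma,\delta\in(0,1]$. The Green's function corresponding to the homogeneous problem $$D^{\delta}D^{\gamma}D^{\beta}D^{\alpha}x(t)=0$$ with boundary conditions $$x(0)=D^{\alpha}x(0)=D^{\beta}D^{\alpha}x(1)=D^{\gamma}D^{\beta}D^{\alpha}x(1)=0$$ is, for $t,s\in[0,1]$, $$G(t,s)=\begin{cases}\displaystyle\frac{t^{\alpha+\beta}}{\gamma}\left[\frac{s^{\gamma}}{\beta(\alpha+\beta)}-\frac{t^{\gamma}}{(\beta+\gamma)(\alpha+\beta+\gamma)}\right] & : t\le s,\\[2ex] \displaystyle\frac{s^{\beta+\gamma}}{\alpha}\left[\frac{t^{\alpha}}{\beta(\beta+\gamma)}-\frac{s^{\alpha}}{(\alpha+\beta)(\alpha+\beta+\gamma)}\right] & : s\le t.\end{cases}$$ That is, for every continuous function $h$ on $[0,1]$, the function $x(t)=\int_0^1G(t,s)h(s)s^{\delta-1}\,ds$ is a solution of $D^{\delta}D^{\gamma}D^{\beta}D^{\alpha}x(t)=h(t)$ on $[0,1]$ satisfying these boundary conditions.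
   Context: For $\alpha\in(0,1]$ the conformable fractional derivative of order $\alpha$ of a function $f$ is $D^{\alpha}f(t):=\lim_{\varepsilon\to0}\frac{f(te^{\varepsilon t^{-\alpha}})-f(t)}{\varepsilon}$ for $t>0$, and $D^{\alpha}f(0):=\lim_{t\to0^+}D^{\alpha}f(t)$; if $f$ is differentiable at $t>0$ then $D^{\alpha}f(t)=t^{1-\alpha}f'(t)$. For functions on $[0,1]$ the derivative at $t=1$ is one-sided. Iterated symbols such as $D^{\gamma}D^{\beta}D^{\alpha}x$ mean $D^{\gamma}(D^{\beta}(D^{\alpha}x))$. The term "Green's function" is meant in the sense spelled out in the claim (kernel of the solution operator with respect to the weight $s^{\delta-1}\,ds$). *)

theory Defs
  imports "HOL-Analysis.Analysis"
begin

text \<open>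
  Functions on [0,1] are represented by functions of type \<^typ>\<open>real \<Rightarrow> real\<close> whose values
  outside [0,1] are never consulted: the increment \<open>e\<close> in the difference quotient ranges only
  over those values for which the displaced point stays in [0,1].  For 0 < t < 1 these form a
  neighbourhood of 0, so the limit is the ordinary two-sided one; for t = 1 they are the
  nonpositive numbers, which gives the one-sided derivative.
\<close>

definition cf_filter :: "real \<Rightarrow> real \<Rightarrow> real filter" where
  "cf_filter \<alpha> t = (at 0 within {e. t * exp (e * t powr (- \<alpha>)) \<in> {0..1}})"

definition cf_quotient :: "real \<Rightarrow> (real \<Rightarrow> real) \<Rightarrow> real \<Rightarrow> real \<Rightarrow> real" where
  "cf_quotient \<alpha> f t e = (f (t * exp (e * t powr (- \<alpha>))) - f t) / e"

text \<open>
  As usual in HOL the derivative is a total function, meaningful only where the limits exist;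
  existence is the separate predicate \<open>cf_differentiable\<close>.  At 0 the latter requires the
  derivative to exist at all points of some interval (0,d) and to converge there.
\<close>

definition cf_deriv_pos :: "real \<Rightarrow> (real \<Rightarrow> real) \<Rightarrow> real \<Rightarrow> real" where
  "cf_deriv_pos \<alpha> f t = Lim (cf_filter \<alpha> t) (cf_quotient \<alpha> f t)"

definition cf_deriv :: "real \<Rightarrow> (real \<Rightarrow> real) \<Rightarrow> real \<Rightarrow> real" where
  "cf_deriv \<alpha> f t =
     (if t = 0 then Lim (at_right 0) (cf_deriv_pos \<alpha> f) else cf_deriv_pos \<alpha> f t)"

definition cf_differentiable_pos :: "real \<Rightarrow> (real \<Rightarrow> real) \<Rightarrow> real \<Rightarrow> bool" where
  "cf_differentiable_pos \<alpha> f t \<longleftrightarrow> (\<exists>L. (cf_quotient \<alpha> f t \<longlongrightarrow> L) (cf_filter \<alpha> t))"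

definition cf_differentiable :: "real \<Rightarrow> (real \<Rightarrow> real) \<Rightarrow> real \<Rightarrow> bool" where
  "cf_differentiable \<alpha> f t \<longleftrightarrow>
     (if t = 0
      then eventually (cf_differentiable_pos \<alpha> f) (at_right 0) \<and>
           (\<exists>L. (cf_deriv_pos \<alpha> f \<longlongrightarrow> L) (at_right 0))
      else cf_differentiable_pos \<alpha> f t)"

definition solves_equation ::
  "real \<Rightarrow> real \<Rightarrow> real \<Rightarrow> real \<Rightarrow> (real \<Rightarrow> real) \<Rightarrow> (real \<Rightarrow> real) \<Rightarrow> bool" where
  "solves_equation \<alpha> \<beta> \<gamma> \<delta> h x \<longleftrightarrow>
     (\<forall>t\<in>{0..1}.
        cf_differentiable \<alpha> x t \<and>
        cf_differentiable \<beta> (cf_deriv \<alpha> x) t \<and>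
        cf_differentiable \<gamma> (cf_deriv \<beta> (cf_deriv \<alpha> x)) t \<and>
        cf_differentiable \<delta> (cf_deriv \<gamma> (cf_deriv \<beta> (cf_deriv \<alpha> x))) t \<and>
        cf_deriv \<delta> (cf_deriv \<gamma> (cf_deriv \<beta> (cf_deriv \<alpha> x))) t = h t)"

definition boundary_conditions :: "real \<Rightarrow> real \<Rightarrow> real \<Rightarrow> (real \<Rightarrow> real) \<Rightarrow> bool" where
  "boundary_conditions \<alpha> \<beta> \<gamma> x \<longleftrightarrow>
     x 0 = 0 \<and>
     cf_deriv \<alpha> x 0 = 0 \<and>
     cf_deriv \<beta> (cf_deriv \<alpha> x) 1 = 0 \<and>
     cf_deriv \<gamma> (cf_deriv \<beta> (cf_deriv \<alpha> x)) 1 = 0"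

definition green_le :: "real \<Rightarrow> real \<Rightarrow> real \<Rightarrow> real \<Rightarrow> real \<Rightarrow> real" where
  "green_le \<alpha> \<beta> \<gamma> t s =
     t powr (\<alpha> + \<beta>) / \<gamma> *
       (s powr \<gamma> / (\<beta> * (\<alpha> + \<beta>)) - t powr \<gamma> / ((\<beta> + \<gamma>) * (\<alpha> + \<beta> + \<gamma>)))"

definition green_ge :: "real \<Rightarrow> real \<Rightarrow> real \<Rightarrow> real \<Rightarrow> real \<Rightarrow> real" where
  "green_ge \<alpha> \<beta> \<gamma> t s =
     s powr (\<beta> + \<gamma>) / \<alpha> *
       (t powr \<alpha> / (\<beta> * (\<beta> + \<gamma>)) - s powr \<alpha> / ((\<alpha> + \<beta>) * (\<alpha> + \<beta> + \<gamma>)))"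

definition green :: "real \<Rightarrow> real \<Rightarrow> real \<Rightarrow> real \<Rightarrow> real \<Rightarrow> real" where
  "green \<alpha> \<beta> \<gamma> t s = (if t \<le> s then green_le \<alpha> \<beta> \<gamma> t s else green_ge \<alpha> \<beta> \<gamma> t s)"

text \<open>
  A kernel \<open>G\<close> is a Green's function with respect to the weight \<open>s powr (\<delta> - 1)\<close> if integration
  against it yields a solution of the boundary value problem for every continuous right-hand
  side.  The weight may be unbounded at 0, so convergence of the integral (in the Lebesgue
  sense) is part of the requirement.  The value of the weight at s = 0 is immaterial.
\<close>

definition is_green_function ::
  "real \<Rightarrow> real \<Rightarrow> real \<Rightarrow> real \<Rightarrow> (real \<Rightarrow> real \<Rightarrow> real) \<Rightarrow> bool" where
  "is_green_function \<alpha> \<beta> \<gamma> \<delta> G \<longleftrightarrow>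
     (\<forall>h. continuous_on {0..1} h \<longrightarrow>
        (\<forall>t\<in>{0..1}. (\<lambda>s. G t s * h s * s powr (\<delta> - 1)) absolutely_integrable_on {0..1}) \<and>
        (let x = (\<lambda>t. integral {0..1} (\<lambda>s. G t s * h s * s powr (\<delta> - 1)))
         in solves_equation \<alpha> \<beta> \<gamma> \<delta> h x \<and> boundary_conditions \<alpha> \<beta> \<gamma> x))"

end

theory Submission
  imports Defs
begin

text \<open>
  Write \<open>w s = h s * s powr (\<delta> - 1)\<close>.  For positive \<open>t\<close> the conformable derivative of order
  \<open>\<alpha>\<close> is \<open>t powr (1 - \<alpha>)\<close> times the ordinary derivative, so the equation can be undone one
  operator at a time.  The last operator together with the last boundary condition forces the third conformable
  derivative of \<open>x\<close> to be minus the integral of \<open>w\<close> over \<open>[t, 1]\<close>, that is, to have the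
  kernel \<open>-1\<close> for \<open>t \<le> s\<close> and \<open>0\<close> for \<open>s \<le> t\<close>.  Three further integrations, from 1
  for the condition at 1 and then twice from 0 for the conditions at 0, turn this kernel into

    \<^item> \<open>(s powr \<gamma> - t powr \<gamma>) / \<gamma>\<close> for \<open>t \<le> s\<close>, and \<open>0\<close> for \<open>s \<le> t\<close>;
    \<^item> \<open>t powr \<beta> / \<gamma> * (s powr \<gamma> / \<beta> - t powr \<gamma> / (\<beta> + \<gamma>))\<close> for \<open>t \<le> s\<close>, and
      \<open>s powr (\<beta> + \<gamma>) / (\<beta> * (\<beta> + \<gamma>))\<close> for \<open>s \<le> t\<close>;
    \<^item> the kernel \<open>green\<close>.

  The proof runs through this chain in the opposite direction, by differentiation.  Each kernel is
  on either side of the diagonal a finite sum of products of powers of \<open>t\<close> and of \<open>s\<close>, so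
  integrating it against \<open>w\<close> gives a combination of powers of \<open>t\<close> with the moments
  \<open>moment w p t\<close>, the integrals of \<open>s powr p * w s\<close> over \<open>[0, t]\<close>
  (\<open>integral_green\<close>).  This avoids differentiating under an integral whose weight may be
  unbounded at 0: moments are continuous on the closed interval and have derivative
  \<open>t powr p * w t\<close> away from 0 (\<open>moment_has_derivative\<close>).  In the first three derivatives the
  terms containing \<open>w t\<close> cancel, because the two branches of each kernel agree on the diagonal; only
  the last kernel jumps there, by 1, and so returns \<open>w\<close>.  The lemma \<open>cf_deriv_eq\<close> translates
  ordinary into conformable derivatives, and reduces the value at 0 to a limit of the explicit
  formula.
\<close>

section \<open>The conformable derivative of a differentiable function\<close>

text \<open>
  Negative increments move \<open>t\<close> towards 0 without reaching it, hence are always admissible; this is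
  what makes the limits unique at the end point 1 too.
\<close>

lemma cf_filter_neq_bot:
  assumes "t \<in> {0<..1}"
  shows "cf_filter \<alpha> t \<noteq> bot"
proof -
  have "t * exp (e * t powr (- \<alpha>)) \<in> {0..1}" if "e < 0" for e
  proof -
    have "t * exp (e * t powr (- \<alpha>)) \<le> 1 * 1"
      using that assms by (intro mult_mono) (auto simp: mult_nonpos_nonneg)
    then show ?thesis using assms by simp
  qed
  then have "at_left 0 \<le> cf_filter \<alpha> t"
    unfolding cf_filter_def by (intro at_le) auto
  then show ?thesis
    using trivial_limit_at_left_real[of "0::real"] by (metis bot.extremum_uniqueI)
qed

text \<open>
  The chain rule: the displaced point \<open>t * exp (e * t powr - \<alpha>)\<close> moves with speed
  \<open>t powr (1 - \<alpha>)\<close> at \<open>e = 0\<close>, which cancels the factor \<open>t powr (\<alpha> - 1)\<close>.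
\<close>

lemma cf_quotient_tendsto:
  assumes t: "t \<in> {0<..1}"
    and f: "(f has_real_derivative t powr (\<alpha> - 1) * L) (at t within {0..1})"
  shows "(cf_quotient \<alpha> f t \<longlongrightarrow> L) (cf_filter \<alpha> t)"
proof -
  define g where "g = (\<lambda>e. t * exp (e * t powr (- \<alpha>)))"
  define S where "S = {e. g e \<in> {0..1}}"
  have "(g has_real_derivative t * t powr (- \<alpha>)) (at 0 within S)"
    unfolding g_def by (auto intro!: derivative_eq_intros)
  moreover have "(f has_real_derivative t powr (\<alpha> - 1) * L) (at (g 0) within g ` S)"
    using f by (rule_tac DERIV_subset[of _ _ _ "{0..1}"]) (auto simp: g_def S_def)
  ultimately have "((f \<circ> g) has_real_derivative (t powr (\<alpha> - 1) * L) * (t * t powr (- \<alpha>)))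
      (at 0 within S)"
    by (intro DERIV_image_chain)
  moreover have "(t powr (\<alpha> - 1) * L) * (t * t powr (- \<alpha>)) = L"
    using t by (simp add: powr_diff powr_minus field_simps)
  ultimately show ?thesis
    by (simp add: has_field_derivative_iff cf_quotient_def[abs_def] cf_filter_def S_def g_def)
qed

text \<open>
  The function \<open>f\<close> is to be an iterated conformable derivative, which is known only on the unit
  interval, whereas \<open>\<phi>\<close> is an explicit formula for it.  At 0 the quotient is never formed: there
  the conformable derivative is the limit of its values at positive points.
\<close>

lemma cf_deriv_eq:
  assumes eq: "\<And>t. t \<in> {0..1} \<Longrightarrow> f t = \<phi> t"
    and deriv: "\<And>t. t \<in> {0<..1} \<Longrightarrow>
      (\<phi> has_real_derivative t powr (\<alpha> - 1) * F t) (at t within {0..1})"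
    and lim: "(F \<longlongrightarrow> F 0) (at_right 0)"
    and t: "t \<in> {0..1}"
  shows "cf_differentiable \<alpha> f t \<and> cf_deriv \<alpha> f t = F t"
proof -
  have quot: "(cf_quotient \<alpha> f t \<longlongrightarrow> F t) (cf_filter \<alpha> t)" if "t \<in> {0<..1}" for t
  proof (rule cf_quotient_tendsto[OF that])
    show "(f has_real_derivative t powr (\<alpha> - 1) * F t) (at t within {0..1})"
      by (rule has_field_derivative_transform_within[OF deriv[OF that] zero_less_one])
         (use that eq in auto)
  qed
  have diff: "cf_differentiable_pos \<alpha> f t" if "t \<in> {0<..1}" for t
    using quot[OF that] by (auto simp: cf_differentiable_pos_def)
  have val: "cf_deriv_pos \<alpha> f t = F t" if "t \<in> {0<..1}" for t
    unfolding cf_deriv_pos_def using tendsto_Lim[OF cf_filter_neq_bot quot] that by blast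
  have near: "eventually (\<lambda>s. s \<in> {0<..1}) (at_right (0::real))"
    using eventually_at_right_real[of 0 1] by (auto elim: eventually_mono)
  have lim': "(cf_deriv_pos \<alpha> f \<longlongrightarrow> F 0) (at_right 0)"
    by (rule Lim_transform_eventually[OF lim]) (use near val in \<open>auto elim: eventually_mono\<close>)
  show ?thesis
  proof (cases "t = 0")
    case True
    have "eventually (cf_differentiable_pos \<alpha> f) (at_right 0)"
      using near diff by (auto elim: eventually_mono)
    with True lim' show ?thesis
      by (auto simp: cf_differentiable_def cf_deriv_def intro: tendsto_Lim)
  next
    case False
    with t diff val show ?thesis
      by (auto simp: cf_differentiable_def cf_deriv_def)
  qed
qed

section \<open>Moments of a weighted function\<close>

lemma absolutely_integrable_continuous_times_powr:
  fixes g :: "real \<Rightarrow> real"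
  assumes "continuous_on {0..1} g" and "0 < \<delta>"
  shows "(\<lambda>s. g s * s powr (\<delta> - 1)) absolutely_integrable_on {0..1}"
proof (rule absolutely_integrable_bounded_measurable_product_real)
  show "g \<in> borel_measurable (lebesgue_on {0..1})"
    using assms by (intro continuous_imp_measurable_on_sets_lebesgue) auto
  show "bounded (g ` {0..1})"
    using assms by (intro compact_imp_bounded compact_continuous_image) auto
  show "(\<lambda>s::real. s powr (\<delta> - 1)) absolutely_integrable_on {0..1}"
    using has_integral_powr_from_0[of "\<delta> - 1" 1] assms
    by (intro nonnegative_absolutely_integrable_1) (auto simp: integrable_on_def)
qed auto

definition moment :: "(real \<Rightarrow> real) \<Rightarrow> real \<Rightarrow> real \<Rightarrow> real" where
  "moment w p t = integral {0..t} (\<lambda>s. s powr p * w s)"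

lemma continuous_on_powr_unit:
  assumes "0 < p"
  shows "continuous_on {0..1} (\<lambda>s::real. s powr p)"
  using assms by (intro continuous_on_powr' continuous_intros) auto

text \<open>The factor \<open>s powr p\<close> only raises the exponent of the weight.\<close>

lemma moment_integrable:
  fixes h :: "real \<Rightarrow> real"
  assumes "continuous_on {0..1} h" and "0 < \<delta>" and "0 \<le> p"
  shows "(\<lambda>s. s powr p * (h s * s powr (\<delta> - 1))) integrable_on {0..1}"
proof -
  have "(\<lambda>s. h s * s powr (p + \<delta> - 1)) integrable_on {0..1}"
    using absolutely_integrable_continuous_times_powr[of h "p + \<delta>"] assms
    by (simp add: set_lebesgue_integral_eq_integral)
  moreover have "h s * s powr (p + \<delta> - 1) = s powr p * (h s * s powr (\<delta> - 1))" for s :: real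
    by (simp add: powr_add[symmetric] algebra_simps)
  ultimately show ?thesis by simp
qed

lemma continuous_on_moment:
  assumes "(\<lambda>s. s powr p * w s) integrable_on {0..1}"
  shows "continuous_on {0..1} (moment w p)"
  using indefinite_integral_continuous_1[OF assms] by (simp add: moment_def[abs_def])

text \<open>
  The fundamental theorem of calculus.  The point 0 has to be left out because the integrand
  may be unbounded there.
\<close>

lemma moment_has_derivative:
  assumes "(\<lambda>s. s powr p * w s) integrable_on {0..1}"
    and "continuous_on {0<..1} w" and t: "t \<in> {0<..1}"
  shows "(moment w p has_real_derivative t powr p * w t) (at t within {0..1})"
proof -
  have "continuous_on {0<..1} (\<lambda>s. s powr p * w s)"
    using assms(2) by (intro continuous_intros) auto
  then have "continuous (at t within {0<..1}) (\<lambda>s. s powr p * w s)"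
    using t by (simp add: continuous_on_eq_continuous_within)
  \<comment> \<open>near a positive point the half-open and the closed interval are the same\<close>
  moreover have "at t within {0<..1} = at t within {0..1}"
    using t by (intro at_within_nhd[of _ "{0<..}"]) auto
  ultimately have "continuous (at t within {0..1} - {}) (\<lambda>s. s powr p * w s)"
    by (simp add: continuous_within)
  from integral_has_vector_derivative_continuous_at[OF assms(1) _ finite.emptyI this] t
  show ?thesis
    by (simp add: moment_def[abs_def] has_real_derivative_iff_has_vector_derivative)
qed

section \<open>The kernel\<close>

text \<open>
  Up to a factor, both brackets have the numerator \<open>\<alpha> + 2 * \<beta> + \<gamma>\<close> over a common denominator: in \<open>green_le\<close>
  the numerator is \<open>(\<beta> + \<gamma>) * (\<alpha> + \<beta> + \<gamma>) - \<beta> * (\<alpha> + \<beta>) = \<gamma> * (\<alpha> + 2 * \<beta> + \<gamma>)\<close>, in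
  \<open>green_ge\<close> it is \<open>(\<alpha> + \<beta>) * (\<alpha> + \<beta> + \<gamma>) - \<beta> * (\<beta> + \<gamma>) = \<alpha> * (\<alpha> + 2 * \<beta> + \<gamma>)\<close>, and
  the factors \<open>\<gamma>\<close> and \<open>\<alpha>\<close> cancel.
\<close>

lemma green_le_eq_green_ge_diagonal:
  assumes "0 < \<alpha>" "0 < \<beta>" "0 < \<gamma>" "0 \<le> s"
  shows "green_le \<alpha> \<beta> \<gamma> s s = green_ge \<alpha> \<beta> \<gamma> s s"
proof (cases "s = 0")
  case True
  then show ?thesis by (simp add: green_le_def green_ge_def)
next
  case False
  define A B C where "A = s powr \<alpha>" and "B = s powr \<beta>" and "C = s powr \<gamma>"
  have "\<alpha> + \<beta> \<noteq> 0" "\<beta> + \<gamma> \<noteq> 0" "\<alpha> + \<beta> + \<gamma> \<noteq> 0" using assms by auto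
  then have
    "A * B / \<gamma> * (C / (\<beta> * (\<alpha> + \<beta>)) - C / ((\<beta> + \<gamma>) * (\<alpha> + \<beta> + \<gamma>))) =
     A * B * C * (\<alpha> + 2 * \<beta> + \<gamma>) / (\<beta> * (\<alpha> + \<beta>) * (\<beta> + \<gamma>) * (\<alpha> + \<beta> + \<gamma>))"
    "B * C / \<alpha> * (A / (\<beta> * (\<beta> + \<gamma>)) - A / ((\<alpha> + \<beta>) * (\<alpha> + \<beta> + \<gamma>))) =
     A * B * C * (\<alpha> + 2 * \<beta> + \<gamma>) / (\<beta> * (\<alpha> + \<beta>) * (\<beta> + \<gamma>) * (\<alpha> + \<beta> + \<gamma>))"
    using assms by (simp add: divide_simps; algebra)+
  then show ?thesis
    by (simp add: green_le_def green_ge_def powr_add A_def B_def C_def)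
qed

text \<open>The two branches are continuous and agree at \<open>s = t\<close>, so they can be glued.\<close>

lemma continuous_on_green:
  assumes "0 < \<alpha>" "0 < \<beta>" "0 < \<gamma>" "t \<in> {0..1}"
  shows "continuous_on {0..1} (green \<alpha> \<beta> \<gamma> t)"
proof -
  have "continuous_on ({t..1} \<union> {0..t})
      (\<lambda>s. if t \<le> s then green_le \<alpha> \<beta> \<gamma> t s else green_ge \<alpha> \<beta> \<gamma> t s)"
  proof (rule continuous_on_If)
    show "continuous_on {t..1} (green_le \<alpha> \<beta> \<gamma> t)" "continuous_on {0..t} (green_ge \<alpha> \<beta> \<gamma> t)"
      unfolding green_le_def[abs_def] green_ge_def[abs_def] using assms
      by (intro continuous_on_mult continuous_on_diff continuous_on_divide continuous_on_powr'
          continuous_on_const continuous_on_id; auto)+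
  qed (use assms green_le_eq_green_ge_diagonal in \<open>force+\<close>)
  moreover have "{t..1} \<union> {0..t} = {0..1}" using assms by auto
  ultimately show ?thesis by (simp add: green_def[abs_def])
qed

text \<open>
  The integral is split at the diagonal \<open>s = t\<close>; on either part the kernel is a sum of two terms
  in which the powers of \<open>t\<close> are constants.  The condition \<open>w 0 = 0\<close> allows the term of
  \<open>green_le\<close> without a power of \<open>s\<close> to be read as the moment of order 0, since
  \<open>0 powr 0 = 0\<close>.
\<close>

lemma integral_green:
  assumes pos: "0 < \<alpha>" "0 < \<beta>" "0 < \<gamma>" and t: "t \<in> {0..1}"
    and w: "\<And>p. 0 \<le> p \<Longrightarrow> (\<lambda>s. s powr p * w s) integrable_on {0..1}"
    and w0: "w 0 = 0"
  shows "integral {0..1} (\<lambda>s. green \<alpha> \<beta> \<gamma> t s * w s) =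
    t powr (\<alpha> + \<beta>) / (\<gamma> * \<beta> * (\<alpha> + \<beta>)) * (moment w \<gamma> 1 - moment w \<gamma> t)
    - t powr (\<alpha> + \<beta> + \<gamma>) / (\<gamma> * (\<beta> + \<gamma>) * (\<alpha> + \<beta> + \<gamma>)) * (moment w 0 1 - moment w 0 t)
    + t powr \<alpha> / (\<alpha> * \<beta> * (\<beta> + \<gamma>)) * moment w (\<beta> + \<gamma>) t
    - moment w (\<alpha> + \<beta> + \<gamma>) t / (\<alpha> * (\<alpha> + \<beta>) * (\<alpha> + \<beta> + \<gamma>))" 
    (is "_ = ?a * _ - ?b * _ + ?c * _ - _ / ?d")
proof -
  let ?m = "\<lambda>p s. s powr p * w s"
  have below: "(?m p has_integral moment w p t) {0..t}" if "0 \<le> p" for p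
    unfolding moment_def using integrable_subinterval_real[OF w[OF that]] t
    by (intro integrable_integral) auto
  have above: "(?m p has_integral moment w p 1 - moment w p t) {t..1}" if "0 \<le> p" for p
  proof -
    have "integral {0..t} (?m p) + integral {t..1} (?m p) = integral {0..1} (?m p)"
      using t w[OF that] by (intro Henstock_Kurzweil_Integration.integral_combine) auto
    moreover have "?m p integrable_on {t..1}"
      using integrable_subinterval_real[OF w[OF that]] t by auto
    ultimately show ?thesis
      unfolding moment_def by (metis add_diff_cancel_left' integrable_integral)
  qed
  have G_ge: "green \<alpha> \<beta> \<gamma> t s * w s = ?c * ?m (\<beta> + \<gamma>) s - ?m (\<alpha> + \<beta> + \<gamma>) s / ?d"
    if "s \<in> {0..t}" for s
  proof -
    have "green \<alpha> \<beta> \<gamma> t s = green_ge \<alpha> \<beta> \<gamma> t s"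
      using that pos green_le_eq_green_ge_diagonal[of \<alpha> \<beta> \<gamma> t]
      by (cases "s = t") (auto simp: green_def)
    then show ?thesis
      by (simp only: green_ge_def) (simp add: powr_add algebra_simps)
  qed
  have G_le: "green \<alpha> \<beta> \<gamma> t s * w s = ?a * ?m \<gamma> s - ?b * ?m 0 s"
    if "s \<in> {t..1}" for s
    using that w0 t by (cases "s = 0") (auto simp: green_def green_le_def powr_add algebra_simps)
  have "((\<lambda>s. green \<alpha> \<beta> \<gamma> t s * w s) has_integral
      ?c * moment w (\<beta> + \<gamma>) t - moment w (\<alpha> + \<beta> + \<gamma>) t / ?d) {0..t}"
    using pos
    by (intro has_integral_eq[OF G_ge[symmetric]] has_integral_diff has_integral_mult_right
        has_integral_divide below) auto
  moreover have "((\<lambda>s. green \<alpha> \<beta> \<gamma> t s * w s) has_integral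
      ?a * (moment w \<gamma> 1 - moment w \<gamma> t) - ?b * (moment w 0 1 - moment w 0 t)) {t..1}"
    using pos
    by (intro has_integral_eq[OF G_le[symmetric]] has_integral_diff has_integral_mult_right
        above) auto
  ultimately show ?thesis
    using t by (subst integral_unique[OF has_integral_combine[of 0 t 1]]) auto
qed

section \<open>Green's function\<close>

theorem theorem4p1:
  fixes \<alpha> \<beta> \<gamma> \<delta> :: real
  assumes "\<alpha> \<in> {0<..1}" and "\<beta> \<in> {0<..1}" and "\<gamma> \<in> {0<..1}" and "\<delta> \<in> {0<..1}"
  shows "(\<forall>s\<in>{0..1}. green_le \<alpha> \<beta> \<gamma> s s = green_ge \<alpha> \<beta> \<gamma> s s) \<and>
         is_green_function \<alpha> \<beta> \<gamma> \<delta> (green \<alpha> \<beta> \<gamma>)"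
proof -
  have pos: "0 < \<alpha>" "0 < \<beta>" "0 < \<gamma>" "0 < \<delta>" using assms by auto
  have "is_green_function \<alpha> \<beta> \<gamma> \<delta> (green \<alpha> \<beta> \<gamma>)"
    unfolding is_green_function_def Let_def
  proof (intro allI impI conjI ballI)
    fix h :: "real \<Rightarrow> real" and t :: real
    assume "continuous_on {0..1} h" "t \<in> {0..1}"
    then show "(\<lambda>s. green \<alpha> \<beta> \<gamma> t s * h s * s powr (\<delta> - 1)) absolutely_integrable_on {0..1}"
      using pos
      by (intro absolutely_integrable_continuous_times_powr continuous_on_mult continuous_on_green)
  next
    fix h :: "real \<Rightarrow> real"
    assume h: "continuous_on {0..1} h"
    \<comment> \<open>\<open>x0\<close>, \<open>y\<close>, \<open>z\<close>, \<open>u\<close> are the closed forms of \<open>x\<close> and of its successive conformable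
      derivatives; the difference \<open>M p 1 - M p t\<close> is the moment over \<open>[t, 1]\<close>\<close>
    define w where "w = (\<lambda>s. h s * s powr (\<delta> - 1))"
    define M where "M = moment w"
    define x where "x = (\<lambda>t. integral {0..1} (\<lambda>s. green \<alpha> \<beta> \<gamma> t s * h s * s powr (\<delta> - 1)))"
    define x0 where "x0 = (\<lambda>t.
      t powr (\<alpha> + \<beta>) / (\<gamma> * \<beta> * (\<alpha> + \<beta>)) * (M \<gamma> 1 - M \<gamma> t)
      - t powr (\<alpha> + \<beta> + \<gamma>) / (\<gamma> * (\<beta> + \<gamma>) * (\<alpha> + \<beta> + \<gamma>)) * (M 0 1 - M 0 t)
      + t powr \<alpha> / (\<alpha> * \<beta> * (\<beta> + \<gamma>)) * M (\<beta> + \<gamma>) t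
      - M (\<alpha> + \<beta> + \<gamma>) t / (\<alpha> * (\<alpha> + \<beta>) * (\<alpha> + \<beta> + \<gamma>)))"
    define y where "y = (\<lambda>t.
      t powr \<beta> / (\<gamma> * \<beta>) * (M \<gamma> 1 - M \<gamma> t)
      - t powr (\<beta> + \<gamma>) / (\<gamma> * (\<beta> + \<gamma>)) * (M 0 1 - M 0 t)
      + M (\<beta> + \<gamma>) t / (\<beta> * (\<beta> + \<gamma>)))"
    define z where "z = (\<lambda>t. ((M \<gamma> 1 - M \<gamma> t) - t powr \<gamma> * (M 0 1 - M 0 t)) / \<gamma>)"
    define u where "u = (\<lambda>t. M 0 t - M 0 1)"

    have int: "(\<lambda>s. s powr p * w s) integrable_on {0..1}" if "0 \<le> p" for p
      using moment_integrable[OF h] pos that by (simp add: w_def)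
    have "continuous_on {0<..1} w"
      unfolding w_def using h
      by (intro continuous_intros) (auto intro: continuous_on_subset)
    then have M_deriv: "(M p has_real_derivative t powr p * w t) (at t within {0..1})"
      if "0 \<le> p" "t \<in> {0<..1}" for p t
      unfolding M_def using int that by (intro moment_has_derivative) auto
    have M_cont: "continuous_on {0..1} (M p)" if "0 \<le> p" for p
      unfolding M_def using int that by (intro continuous_on_moment)
    have powr_deriv: "((\<lambda>s. s powr p) has_real_derivative p * t powr (p - 1)) (at t within {0..1})"
      if "t \<in> {0<..1}" for p t
      using has_real_derivative_powr[of t p] that by (auto intro: has_field_derivative_at_within)
    note deriv = DERIV_const M_deriv powr_deriv DERIV_add DERIV_diff DERIV_cdivide DERIV_mult
    note cont = continuous_intros continuous_on_powr_unit M_cont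

    have nz: "\<alpha> + \<beta> \<noteq> 0" "\<beta> + \<gamma> \<noteq> 0" "\<alpha> + \<beta> + \<gamma> \<noteq> 0" "\<alpha> \<noteq> 0" "\<beta> \<noteq> 0" "\<gamma> \<noteq> 0"
      using pos by auto
    have x_eq: "x t = x0 t" if "t \<in> {0..1}" for t
      using integral_green[of \<alpha> \<beta> \<gamma> t w] int pos that
      by (simp add: x_def x0_def M_def w_def mult.assoc)

    have X: "cf_differentiable \<alpha> x t \<and> cf_deriv \<alpha> x t = y t" if "t \<in> {0..1}" for t
    proof (rule cf_deriv_eq[OF x_eq _ _ that])
      show "(y \<longlongrightarrow> y 0) (at_right 0)"
        unfolding y_def using pos
        by (intro continuous_on_Icc_at_rightD[OF _ zero_less_one] cont) auto
    next
      fix t :: real assume t: "t \<in> {0<..1}"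
      \<comment> \<open>the terms with \<open>w t\<close> add up to \<open>w t\<close> times the difference of the two branches of the
        kernel at \<open>s = t\<close>, which is 0; the same happens for \<open>y\<close> and \<open>z\<close> below\<close>
      show "(x0 has_real_derivative t powr (\<alpha> - 1) * y t) (at t within {0..1})"
        unfolding x0_def
        by (rule DERIV_cong, (rule deriv t | use pos in simp; fail)+)
           (use t nz in \<open>simp add: y_def powr_add powr_diff\<close>, simp add: divide_simps,
            simp add: algebra_simps)
    qed
    have Y: "cf_differentiable \<beta> (cf_deriv \<alpha> x) t \<and> cf_deriv \<beta> (cf_deriv \<alpha> x) t = z t"
      if "t \<in> {0..1}" for t
    proof (rule cf_deriv_eq[OF _ _ _ that])
      show "(z \<longlongrightarrow> z 0) (at_right 0)"
        unfolding z_def using pos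
        by (intro continuous_on_Icc_at_rightD[OF _ zero_less_one] cont) auto
    next
      fix t :: real assume t: "t \<in> {0<..1}"
      show "(y has_real_derivative t powr (\<beta> - 1) * z t) (at t within {0..1})"
        unfolding y_def
        by (rule DERIV_cong, (rule deriv t | use pos in simp; fail)+)
           (use t nz in \<open>simp add: z_def powr_add powr_diff\<close>, simp add: divide_simps,
            simp add: algebra_simps)
    qed (use X in auto)
    have Z: "cf_differentiable \<gamma> (cf_deriv \<beta> (cf_deriv \<alpha> x)) t \<and>
        cf_deriv \<gamma> (cf_deriv \<beta> (cf_deriv \<alpha> x)) t = u t"
      if "t \<in> {0..1}" for t
    proof (rule cf_deriv_eq[OF _ _ _ that])
      show "(u \<longlongrightarrow> u 0) (at_right 0)"
        unfolding u_def
        by (intro continuous_on_Icc_at_rightD[OF _ zero_less_one] cont) auto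
    next
      fix t :: real assume t: "t \<in> {0<..1}"
      show "(z has_real_derivative t powr (\<gamma> - 1) * u t) (at t within {0..1})"
        unfolding z_def
        by (rule DERIV_cong, (rule deriv t | use pos in simp; fail)+)
           (use t nz in \<open>simp add: u_def powr_add powr_diff\<close>, simp add: divide_simps,
            simp add: algebra_simps)
    qed (use Y in auto)
    have U: "cf_differentiable \<delta> (cf_deriv \<gamma> (cf_deriv \<beta> (cf_deriv \<alpha> x))) t \<and>
        cf_deriv \<delta> (cf_deriv \<gamma> (cf_deriv \<beta> (cf_deriv \<alpha> x))) t = h t"
      if "t \<in> {0..1}" for t
    proof (rule cf_deriv_eq[OF _ _ _ that])
      show "(h \<longlongrightarrow> h 0) (at_right 0)"
        using h by (rule continuous_on_Icc_at_rightD) simp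
    next
      fix t :: real assume t: "t \<in> {0<..1}"
      show "(u has_real_derivative t powr (\<delta> - 1) * h t) (at t within {0..1})"
        using M_deriv[of 0 t] t
        by (auto simp: u_def w_def mult.commute intro!: derivative_eq_intros)
    qed (use Z in auto)
    show "solves_equation \<alpha> \<beta> \<gamma> \<delta> h x"
      using X Y Z U by (auto simp: solves_equation_def)
    show "boundary_conditions \<alpha> \<beta> \<gamma> x"
      using X[of 0] Y[of 1] Z[of 1] x_eq[of 0]
      by (simp add: boundary_conditions_def x0_def y_def z_def u_def M_def moment_def)
  qed
  then show ?thesis
    using pos green_le_eq_green_ge_diagonal by auto
qed

end
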